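(* Let $(\mathcal T,\rightarrow)$ be the grafting pre-Lie algebra of rooted trees, and let $V$ be the vector space spanned by the couples $(t,s)$ where $t$ is a rooted tree and $s=P^{c_0}(t)$ is the pruning of $t$ by an admissible cut $c_0$ of $t$. For $t_1\in\mathcal T$ and $(t_2,s_2)\in V$ set $$t_1\Diamond(t_2,s_2):=\sum_{v\in\mathcal V(s_2)}\big(t_1\rightarrow_v t_2,\;t_1\rightarrow_v s_2\big),$$ extended bilinearly. Then, equipped with $\Diamond$, $V$ is a left pre-Lie module on $\mathcal T$. In other words, for any $t_1,t_2\in\mathcal T$ and $(t_3,s_3)\in V$, $$t_1\Diamond\big[t_2\Diamond(t_3,s_3)\big]-(t_1\rightarrow t_2)\Diamond(t_3,s_3)=t_2\Diamond\big[t_1\Diamond(t_3,s_3)\big]-(t_2\rightarrow t_1)\Diamond(t_3,s_3).$$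
   Context: Rooted trees are finite, non-planar, non-empty; $\mathcal T$ is the vector space they span. A forest is a finite (possibly empty) disjoint union of rooted trees. For a tree $t$, a tree or forest $s$, and a vertex $v$ of $s$, $t\rightarrow_v s$ is obtained by grafting the root of $t$ on the vertex $v$ of $s$ (adding an edge from $v$ to the root of $t$). The grafting product on $\mathcal T$ is $t\rightarrow s=\sum_{v}t\rightarrow_v s$, summed over all vertices $v$ of $s$; it is a left pre-Lie product. An admissible cut $c$ of a tree $t$ is a collection of edges such that any path from the root to a leaf contains at most one edge of the collection. The pruning $P^c(t)$ is the subforest above the cut. The empty cut (pruning empty) and the total cut (pruning $t$) are both counted as admissible. In a couple $(t,s)\in V$, $s$ is regarded as a subforest of $t$, and $\mathcal V(s)$ is its set of vertices. A left module over a left pre-Lie algebra $(\mathcal A,\circ)$ is a vector space $\mathcal M$ with a bilinear map $\succ:\mathcal A\otimes\mathcal M\to\mathcal M$ such that $a\succ(b\succ m)-(a\circ b)\succ m=b\succ(a\succ m)-(b\circ a)\succ m$ for all $a,b\in\mathcal A$, $m\in\mathcal M$. *)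

theory Defs
  imports Complex_Main "HOL-Library.Poly_Mapping"
begin

section \<open>Concrete rooted forests\<close>

datatype 'a digraph = Digraph (verts: "'a set") (edges: "('a \<times> 'a) set")

definition roots :: "'a digraph \<Rightarrow> 'a set" where
  "roots G = {r \<in> verts G. \<forall>x. (x, r) \<notin> edges G}"

definition leaves :: "'a digraph \<Rightarrow> 'a set" where
  "leaves G = {l \<in> verts G. \<forall>y. (l, y) \<notin> edges G}"

text \<open>Edges point from a parent to its child. The empty graph is a forest, but not a tree.\<close>

definition is_forest :: "'a digraph \<Rightarrow> bool" where
  "is_forest G \<longleftrightarrow> finite (verts G) \<and> edges G \<subseteq> verts G \<times> verts G \<and> acyclic (edges G) \<and>
     (\<forall>x y z. (x, z) \<in> edges G \<longrightarrow> (y, z) \<in> edges G \<longrightarrow> x = y)"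

definition is_tree :: "'a digraph \<Rightarrow> bool" where
  "is_tree G \<longleftrightarrow> is_forest G \<and> (\<exists>!r. r \<in> roots G)"

definition the_root :: "'a digraph \<Rightarrow> 'a" where
  "the_root G = (THE r. r \<in> roots G)"

definition graph_iso :: "('a \<Rightarrow> 'b) \<Rightarrow> 'a digraph \<Rightarrow> 'b digraph \<Rightarrow> bool" where
  "graph_iso f G H \<longleftrightarrow> bij_betw f (verts G) (verts H) \<and>
     (\<forall>x\<in>verts G. \<forall>y\<in>verts G. (x, y) \<in> edges G \<longleftrightarrow> (f x, f y) \<in> edges H)"

section \<open>Admissible cuts and pruning\<close>

definition root_leaf_path :: "'a digraph \<Rightarrow> 'a list \<Rightarrow> bool" where
  "root_leaf_path G p \<longleftrightarrow> p \<noteq> [] \<and> hd p \<in> roots G \<and> last p \<in> leaves G \<and>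
     successively (\<lambda>x y. (x, y) \<in> edges G) p"

definition path_edges :: "'a list \<Rightarrow> ('a \<times> 'a) set" where
  "path_edges p = set (zip p (tl p))"

text \<open>The total cut, whose pruning is the whole tree, is not given by a set of edges of the tree.\<close>

datatype 'a cut = Edge_Cut "('a \<times> 'a) set" | Total_Cut

fun admissible :: "'a digraph \<Rightarrow> 'a cut \<Rightarrow> bool" where
  "admissible G (Edge_Cut c) \<longleftrightarrow>
     c \<subseteq> edges G \<and> (\<forall>p. root_leaf_path G p \<longrightarrow> card (c \<inter> path_edges p) \<le> 1)"
| "admissible G Total_Cut \<longleftrightarrow> True"

definition induced :: "'a digraph \<Rightarrow> 'a set \<Rightarrow> 'a digraph" where
  "induced G S = Digraph S (edges G \<inter> S \<times> S)"

fun pruning :: "'a digraph \<Rightarrow> 'a cut \<Rightarrow> 'a digraph" where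
  "pruning G (Edge_Cut c) =
     induced G {v \<in> verts G. \<exists>(x, y)\<in>c. (y, v) \<in> (edges G)\<^sup>*}"
| "pruning G Total_Cut = G"

definition is_couple :: "'a digraph \<times> 'a digraph \<Rightarrow> bool" where
  "is_couple = (\<lambda>(t, s). is_tree t \<and> (\<exists>c. admissible t c \<and> s = pruning t c))"

section \<open>Grafting\<close>

text \<open>The vertices of \<open>t\<close> and \<open>s\<close> are made disjoint: those of \<open>t\<close> become even,
  those of \<open>s\<close> odd. Here \<open>t\<close> is a tree and \<open>s\<close> a tree or a forest. If \<open>s\<close> is a subforest of \<open>t'\<close>,
  then \<open>graft t v s\<close> is literally a subforest of \<open>graft t v t'\<close>.\<close>

abbreviation evn :: "nat \<Rightarrow> nat" where "evn x \<equiv> 2 * x"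
abbreviation odn :: "nat \<Rightarrow> nat" where "odn x \<equiv> 2 * x + 1"

definition graft :: "nat digraph \<Rightarrow> nat \<Rightarrow> nat digraph \<Rightarrow> nat digraph" where
  "graft t v s = Digraph (evn ` verts t \<union> odn ` verts s)
     (map_prod evn evn ` edges t \<union> map_prod odn odn ` edges s \<union> {(odn v, evn (the_root t))})"

section \<open>Isomorphism classes\<close>

definition tree_rel :: "nat digraph \<Rightarrow> nat digraph \<Rightarrow> bool" where
  "tree_rel t t' \<longleftrightarrow> is_tree t \<and> is_tree t' \<and> (\<exists>f. graph_iso f t t')"

text \<open>The second component of a couple is a subforest of the first, so an isomorphism of
  couples is one isomorphism of trees that carries one subforest onto the other.\<close>

definition couple_rel :: "nat digraph \<times> nat digraph \<Rightarrow> nat digraph \<times> nat digraph \<Rightarrow> bool" where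
  "couple_rel = (\<lambda>(t, s) (t', s'). is_couple (t, s) \<and> is_couple (t', s') \<and>
     (\<exists>f. graph_iso f t t' \<and> graph_iso f s s'))"

lemma graph_iso_id: "graph_iso id G G"
  by (simp add: graph_iso_def bij_betw_def)

lemma graph_iso_comp:
  "graph_iso f G H \<Longrightarrow> graph_iso g H K \<Longrightarrow> graph_iso (g \<circ> f) G K"
  unfolding graph_iso_def by (auto intro: bij_betw_trans simp: bij_betw_apply)

lemma graph_iso_sym:
  assumes f: "graph_iso f G H" and inj: "inj_on f A" and sub: "verts G \<subseteq> A"
  shows "graph_iso (inv_into A f) H G"
proof -
  have b: "bij_betw f (verts G) (verts H)" using f by (simp add: graph_iso_def)
  have inv: "inv_into A f (f x) = x" if "x \<in> verts G" for x
    using that inj sub by (auto intro: inv_into_f_f)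
  have H: "verts H = f ` verts G" using b by (simp add: bij_betw_def)
  have "bij_betw (inv_into A f) (verts H) (verts G)"
    unfolding H by (auto simp: bij_betw_def inj_on_def inv image_image)
  then show ?thesis using f by (auto simp: graph_iso_def H inv)
qed

lemma couple_verts: "is_couple (t, s) \<Longrightarrow> verts s \<subseteq> verts t"
proof -
  assume "is_couple (t, s)"
  then obtain c where "s = pruning t c" by (auto simp: is_couple_def)
  then show ?thesis by (cases c) (auto simp: induced_def)
qed

definition single_vertex :: "nat digraph" where "single_vertex = Digraph {0} {}"

lemma single_vertex_tree: "is_tree single_vertex"
  by (auto simp: single_vertex_def is_tree_def is_forest_def roots_def acyclic_def)

lemma single_vertex_couple: "is_couple (single_vertex, single_vertex)"
  using single_vertex_tree by (auto simp: is_couple_def intro!: exI[of _ Total_Cut])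

quotient_type rtree = "nat digraph" / partial: tree_rel
proof (rule part_equivpI)
  show "\<exists>x. tree_rel x x" using single_vertex_tree graph_iso_id by (auto simp: tree_rel_def)
  show "symp tree_rel"
  proof (rule sympI)
    fix t t' assume "tree_rel t t'"
    then obtain f where "is_tree t" "is_tree t'" and f: "graph_iso f t t'"
      by (auto simp: tree_rel_def)
    moreover have "graph_iso (inv_into (verts t) f) t' t"
      using f by (intro graph_iso_sym) (auto simp: graph_iso_def bij_betw_def)
    ultimately show "tree_rel t' t" by (auto simp: tree_rel_def)
  qed
  show "transp tree_rel"
    by (rule transpI) (auto simp: tree_rel_def intro: graph_iso_comp)
qed

quotient_type couple = "nat digraph \<times> nat digraph" / partial: couple_rel
proof (rule part_equivpI)
  show "\<exists>x. couple_rel x x"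
    using single_vertex_couple graph_iso_id by (auto simp: couple_rel_def)
  show "symp couple_rel"
  proof (rule sympI, clarify)
    fix t s t' s' assume "couple_rel (t, s) (t', s')"
    then obtain f where c: "is_couple (t, s)" "is_couple (t', s')"
      and f: "graph_iso f t t'" "graph_iso f s s'"
      by (auto simp: couple_rel_def)
    have inj: "inj_on f (verts t)" using f by (auto simp: graph_iso_def bij_betw_def)
    have "graph_iso (inv_into (verts t) f) t' t" "graph_iso (inv_into (verts t) f) s' s"
      using graph_iso_sym[OF f(1) inj] graph_iso_sym[OF f(2) inj] couple_verts[OF c(1)] by auto
    then show "couple_rel (t', s') (t, s)" using c by (auto simp: couple_rel_def)
  qed
  show "transp couple_rel"
    by (rule transpI) (auto simp: couple_rel_def split: prod.splits intro: graph_iso_comp)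
qed

section \<open>Grafting is compatible with isomorphisms\<close>

lemma nat_evn_odn: obtains x where "(n::nat) = evn x" | x where "n = odn x"
  by (metis evenE oddE)

lemma evn_odn_neq [simp]: "evn x \<noteq> odn y" "odn y \<noteq> evn x"
  by presburger+

lemma graft_verts [simp]:
  "evn x \<in> verts (graft t v s) \<longleftrightarrow> x \<in> verts t"
  "odn x \<in> verts (graft t v s) \<longleftrightarrow> x \<in> verts s"
  using evn_odn_neq by (auto simp: graft_def)

lemma graft_edges [simp]:
  "(evn x, evn y) \<in> edges (graft t v s) \<longleftrightarrow> (x, y) \<in> edges t"
  "(odn x, odn y) \<in> edges (graft t v s) \<longleftrightarrow> (x, y) \<in> edges s"
  "(evn x, odn y) \<notin> edges (graft t v s)"
  "(odn x, evn y) \<in> edges (graft t v s) \<longleftrightarrow> x = v \<and> y = the_root t"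
  using evn_odn_neq by (auto simp: graft_def)

lemma root_props:
  assumes "is_tree t"
  shows "the_root t \<in> roots t" "r \<in> roots t \<Longrightarrow> r = the_root t" "the_root t \<in> verts t" "(x, the_root t) \<notin> edges t"
proof -
  have ex: "\<exists>!r. r \<in> roots t" using assms by (simp add: is_tree_def)
  show 1: "the_root t \<in> roots t" unfolding the_root_def by (rule theI') (rule ex)
  show "r \<in> roots t \<Longrightarrow> r = the_root t" using ex 1 by blast
  show "the_root t \<in> verts t" "(x, the_root t) \<notin> edges t" using 1 by (auto simp: roots_def)
qed

lemma forest_finite_edges: "is_forest G \<Longrightarrow> finite (edges G)"
  unfolding is_forest_def by (meson finite_SigmaI finite_subset)

lemma root_reaches:
  assumes t: "is_tree t" and "b \<in> verts t"
  shows "(the_root t, b) \<in> (edges t)\<^sup>*"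
proof -
  have F: "is_forest t" using t by (simp add: is_tree_def)
  have "wf (edges t)"
    using F forest_finite_edges[OF F] by (auto simp: is_forest_def intro: finite_acyclic_wf)
  then show ?thesis using assms(2)
  proof (induction b rule: wf_induct_rule)
    case (less b)
    show ?case
    proof (cases "b \<in> roots t")
      case True
      then show ?thesis using root_props(2)[OF t] by auto
    next
      case False
      then obtain x where x: "(x, b) \<in> edges t" using less.prems by (auto simp: roots_def)
      then have "x \<in> verts t" using F by (auto simp: is_forest_def)
      then show ?thesis using less.IH[OF x] x by auto
    qed
  qed
qed

lemma graft_reach_evn:
  assumes "(evn a, z) \<in> (edges (graft t v s))\<^sup>*"
  shows "\<exists>b. z = evn b \<and> (a, b) \<in> (edges t)\<^sup>*"
  using assms
proof (induction rule: rtrancl_induct)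
  case (step y z)
  then obtain b where b: "y = evn b" "(a, b) \<in> (edges t)\<^sup>*" by blast
  show ?case
  proof (cases z rule: nat_evn_odn)
    case (1 x)
    then have "(b, x) \<in> edges t" using step.hyps(2) b(1) by simp
    then show ?thesis using 1 b(2) by (auto intro: rtrancl.rtrancl_into_rtrancl)
  next
    case (2 x)
    then show ?thesis using step.hyps(2) b(1) graft_edges(3) by blast
  qed
qed auto

lemma graft_reach_odn:
  assumes "(odn a, z) \<in> (edges (graft t v s))\<^sup>*"
  shows "(\<exists>b. z = odn b \<and> (a, b) \<in> (edges s)\<^sup>*) \<or>
    (\<exists>b. z = evn b \<and> (a, v) \<in> (edges s)\<^sup>* \<and> (the_root t, b) \<in> (edges t)\<^sup>*)"
  using assms
proof (induction rule: rtrancl_induct)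
  case (step y z)
  show ?case
  proof (cases z rule: nat_evn_odn)
    case (1 x)
    show ?thesis
    proof (cases y rule: nat_evn_odn)
      case y: (1 u)
      have "(u, x) \<in> edges t" using step.hyps(2) 1 y by simp
      moreover have "(a, v) \<in> (edges s)\<^sup>*" "(the_root t, u) \<in> (edges t)\<^sup>*"
        using step.IH y evn_odn_neq by auto
      ultimately show ?thesis using 1 by (blast intro: rtrancl.rtrancl_into_rtrancl)
    next
      case y: (2 u)
      have "u = v" "x = the_root t" using step.hyps(2) unfolding 1 y graft_edges by auto
      moreover have "(a, u) \<in> (edges s)\<^sup>*" using step.IH y evn_odn_neq by auto
      ultimately show ?thesis using 1 by blast
    qed
  next
    case (2 x)
    show ?thesis
    proof (cases y rule: nat_evn_odn)
      case y: (1 u)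
      then show ?thesis using step.hyps(2) unfolding 2 y using graft_edges(3) by blast
    next
      case y: (2 u)
      have "(u, x) \<in> edges s" using step.hyps(2) unfolding 2 y graft_edges .
      moreover have "(a, u) \<in> (edges s)\<^sup>*" using step.IH y evn_odn_neq by auto
      ultimately show ?thesis using 2 by (blast intro: rtrancl.rtrancl_into_rtrancl)
    qed
  qed
qed auto

lemma graft_reach_evn_iff [simp]:
  "(evn a, evn b) \<in> (edges (graft t v s))\<^sup>* \<longleftrightarrow> (a, b) \<in> (edges t)\<^sup>*"
proof
  assume "(a, b) \<in> (edges t)\<^sup>*"
  then show "(evn a, evn b) \<in> (edges (graft t v s))\<^sup>*"
    by (induction rule: rtrancl_induct) (auto intro: rtrancl.rtrancl_into_rtrancl)
qed (use graft_reach_evn in fastforce)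

lemma graft_reach_odn_iff [simp]:
  "(odn a, odn b) \<in> (edges (graft t v s))\<^sup>* \<longleftrightarrow> (a, b) \<in> (edges s)\<^sup>*"
proof
  assume "(a, b) \<in> (edges s)\<^sup>*"
  then show "(odn a, odn b) \<in> (edges (graft t v s))\<^sup>*"
  proof (induction rule: rtrancl_induct)
    case (step y z)
    then have "(odn y, odn z) \<in> edges (graft t v s)" unfolding graft_edges by simp
    then show ?case using step.IH by (rule rtrancl_into_rtrancl[rotated])
  qed auto
next
  assume "(odn a, odn b) \<in> (edges (graft t v s))\<^sup>*"
  from graft_reach_odn[OF this] show "(a, b) \<in> (edges s)\<^sup>*" using evn_odn_neq by auto
qed

lemma graft_reach_odn_evn_iff:
  "(odn a, evn b) \<in> (edges (graft t v s))\<^sup>* \<longleftrightarrow> (a, v) \<in> (edges s)\<^sup>* \<and> (the_root t, b) \<in> (edges t)\<^sup>*"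
proof
  assume "(odn a, evn b) \<in> (edges (graft t v s))\<^sup>*"
  from graft_reach_odn[OF this] show "(a, v) \<in> (edges s)\<^sup>* \<and> (the_root t, b) \<in> (edges t)\<^sup>*"
    using evn_odn_neq by auto
next
  assume *: "(a, v) \<in> (edges s)\<^sup>* \<and> (the_root t, b) \<in> (edges t)\<^sup>*"
  have "(odn a, odn v) \<in> (edges (graft t v s))\<^sup>*" "(evn (the_root t), evn b) \<in> (edges (graft t v s))\<^sup>*"
    unfolding graft_reach_odn_iff graft_reach_evn_iff using * by auto
  moreover have "(odn v, evn (the_root t)) \<in> edges (graft t v s)" by (simp add: graft_def)
  ultimately show "(odn a, evn b) \<in> (edges (graft t v s))\<^sup>*"
    by (meson converse_rtrancl_into_rtrancl rtrancl_trans)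
qed

lemma graft_forest:
  assumes t: "is_tree t" and s: "is_forest s" and v: "v \<in> verts s"
  shows "is_forest (graft t v s)"
proof -
  let ?E = "edges (graft t v s)"
  have F: "is_forest t" using t by (simp add: is_tree_def)
  have "finite (verts (graft t v s))" using F s by (auto simp: graft_def is_forest_def)
  moreover have "?E \<subseteq> verts (graft t v s) \<times> verts (graft t v s)"
    using F s v root_props(3)[OF t] by (auto simp: graft_def is_forest_def)
  moreover have "acyclic ?E"
  proof (unfold acyclic_def, intro allI notI)
    fix z assume "(z, z) \<in> ?E\<^sup>+"
    then obtain y where y: "(z, y) \<in> ?E" "(y, z) \<in> ?E\<^sup>*" by (meson tranclD)
    have A: "(x, x) \<notin> (edges t)\<^sup>+" "(x, x) \<notin> (edges s)\<^sup>+" for x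
      using F s by (auto simp: is_forest_def acyclic_def)
    show False
    proof (cases z rule: nat_evn_odn)
      case z: (1 x)
      show False
      proof (cases y rule: nat_evn_odn)
        case (1 u)
        then have "(x, u) \<in> edges t" "(u, x) \<in> (edges t)\<^sup>*" using y z by auto
        then show False using A(1) by (meson rtrancl_into_trancl2)
      next
        case (2 u)
        then show False using y(1) z graft_edges(3) by blast
      qed
    next
      case z: (2 x)
      show False
      proof (cases y rule: nat_evn_odn)
        case (1 u)
        then show False using graft_reach_evn[of u z] y(2) z evn_odn_neq by auto
      next
        case (2 u)
        have "(x, u) \<in> edges s" using y(1) unfolding z 2 graft_edges .
        moreover have "(u, x) \<in> (edges s)\<^sup>*" using y(2) unfolding z 2 graft_reach_odn_iff .
        ultimately show False using A(2) by (meson rtrancl_into_trancl2)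
      qed
    qed
  qed
  moreover have "x = y" if xy: "(x, z) \<in> ?E" "(y, z) \<in> ?E" for x y z
  proof -
    have U: "\<And>a b c. (a, c) \<in> edges t \<Longrightarrow> (b, c) \<in> edges t \<Longrightarrow> a = b"
      "\<And>a b c. (a, c) \<in> edges s \<Longrightarrow> (b, c) \<in> edges s \<Longrightarrow> a = b"
      using F s unfolding is_forest_def by blast+
    show ?thesis using xy U root_props(4)[OF t] evn_odn_neq
      unfolding graft_def by (auto 4 3)
  qed
  ultimately show ?thesis unfolding is_forest_def by blast
qed

lemma graft_roots:
  assumes t: "is_tree t"
  shows "roots (graft t v s) = odn ` roots s"
proof (rule set_eqI)
  fix z
  have F: "is_forest t" using t by (simp add: is_tree_def)
  show "z \<in> roots (graft t v s) \<longleftrightarrow> z \<in> odn ` roots s"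
  proof (cases z rule: nat_evn_odn)
    case (1 x)
    have "z \<notin> roots (graft t v s)"
    proof
      assume r: "z \<in> roots (graft t v s)"
      then have "x \<in> verts t" unfolding 1 roots_def using graft_verts(1) by blast
      moreover have "(y, x) \<notin> edges t" for y
        using r graft_edges(1)[of y x t v s] unfolding 1 roots_def by blast
      ultimately have "x = the_root t" using root_props(2)[OF t] by (auto simp: roots_def)
      then have "(odn v, z) \<in> edges (graft t v s)" unfolding 1 graft_edges by simp
      then show False using r by (auto simp: roots_def)
    qed
    then show ?thesis using 1 evn_odn_neq by auto
  next
    case (2 x)
    have "(\<exists>y. (y, odn x) \<in> edges (graft t v s)) \<longleftrightarrow> (\<exists>y. (y, x) \<in> edges s)"
      by (metis graft_edges(2,3) nat_evn_odn)
    then have "z \<in> roots (graft t v s) \<longleftrightarrow> x \<in> roots s"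
      unfolding 2 roots_def using graft_verts(2)[of x t v s] by blast
    then show ?thesis using 2 by auto
  qed
qed

lemma graft_tree: "is_tree t \<Longrightarrow> is_tree s \<Longrightarrow> v \<in> verts s \<Longrightarrow> is_tree (graft t v s)"
  using graft_forest[of t s v] graft_roots[of t v s] unfolding is_tree_def by auto

definition sum_map :: "(nat \<Rightarrow> nat) \<Rightarrow> (nat \<Rightarrow> nat) \<Rightarrow> nat \<Rightarrow> nat" where
  "sum_map f g n = (if even n then evn (f (n div 2)) else odn (g (n div 2)))"

lemma sum_map_simps [simp]: "sum_map f g (evn x) = evn (f x)" "sum_map f g (odn x) = odn (g x)"
  by (simp_all add: sum_map_def)

lemma iso_root:
  assumes f: "graph_iso f t t'" and t: "is_tree t" "is_tree t'"
  shows "f (the_root t) = the_root t'"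
proof (rule root_props(2)[OF t(2)])
  have "(y, f (the_root t)) \<notin> edges t'" for y
  proof
    assume y: "(y, f (the_root t)) \<in> edges t'"
    then have "y \<in> verts t'" using t by (auto simp: is_tree_def is_forest_def)
    then obtain x where "x \<in> verts t" "y = f x"
      using f unfolding graph_iso_def bij_betw_def by (metis imageE)
    then show False using y f root_props(3,4)[OF t(1)] by (auto simp: graph_iso_def)
  qed
  moreover have "f (the_root t) \<in> verts t'"
    using f root_props(3)[OF t(1)] by (auto simp: graph_iso_def bij_betw_def)
  ultimately show "f (the_root t) \<in> roots t'" by (auto simp: roots_def)
qed

lemma graft_iso:
  assumes f: "graph_iso f t t'" and t: "is_tree t" "is_tree t'"
    and g: "graph_iso g s s'" and inj: "inj_on g (insert v (verts s))"
  shows "graph_iso (sum_map f g) (graft t v s) (graft t' (g v) s')"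
proof -
  have fb: "inj_on f (verts t)" "verts t' = f ` verts t" using f by (auto simp: graph_iso_def bij_betw_def)
  have gb: "inj_on g (verts s)" "verts s' = g ` verts s" using g by (auto simp: graph_iso_def bij_betw_def)
  have V: "verts (graft a w b) = evn ` verts a \<union> odn ` verts b" for a w b by (simp add: graft_def)
  have "inj_on (sum_map f g) (verts (graft t v s))"
  proof (rule inj_onI)
    fix x y assume x: "x \<in> verts (graft t v s)" and y: "y \<in> verts (graft t v s)"
      and e: "sum_map f g x = sum_map f g y"
    show "x = y"
    proof (cases x rule: nat_evn_odn; cases y rule: nat_evn_odn)
      fix a b assume *: "x = evn a" "y = evn b"
      have "a \<in> verts t" "b \<in> verts t" "f a = f b"
        using x y e unfolding * graft_verts sum_map_simps by auto
      then show ?thesis using fb(1) * by (simp add: inj_on_def)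
    next
      fix a b assume *: "x = odn a" "y = odn b"
      have "a \<in> verts s" "b \<in> verts s" "g a = g b"
        using x y e unfolding * graft_verts sum_map_simps by auto
      then show ?thesis using gb(1) * by (simp add: inj_on_def)
    qed (use e evn_odn_neq in \<open>simp_all only: sum_map_simps\<close>)
  qed
  moreover have "sum_map f g ` verts (graft t v s) = verts (graft t' (g v) s')"
    unfolding V image_Un image_image sum_map_simps fb(2) gb(2) ..
  moreover have "(x, y) \<in> edges (graft t v s) \<longleftrightarrow>
      (sum_map f g x, sum_map f g y) \<in> edges (graft t' (g v) s')"
    if xy: "x \<in> verts (graft t v s)" "y \<in> verts (graft t v s)" for x y
  proof (cases x rule: nat_evn_odn)
    case x: (1 a)
    then have a: "a \<in> verts t" using xy(1) graft_verts(1) by blast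
    show ?thesis
    proof (cases y rule: nat_evn_odn)
      case (1 b)
      then have "b \<in> verts t" using xy(2) graft_verts(1) by blast
      then show ?thesis unfolding x 1 sum_map_simps graft_edges using f a by (simp add: graph_iso_def)
    next
      case (2 b)
      then show ?thesis unfolding x 2 sum_map_simps using graft_edges(3) by blast
    qed
  next
    case x: (2 a)
    then have a: "a \<in> verts s" using xy(1) graft_verts(2) by blast
    show ?thesis
    proof (cases y rule: nat_evn_odn)
      case (1 b)
      then have b: "b \<in> verts t" using xy(2) graft_verts(1) by blast
      have "g a = g v \<longleftrightarrow> a = v" using inj a by (auto simp: inj_on_def)
      moreover have "f b = the_root t' \<longleftrightarrow> b = the_root t"
        using iso_root[OF f t] fb(1) b root_props(3)[OF t(1)] by (metis inj_onD)
      ultimately show ?thesis unfolding x 1 sum_map_simps graft_edges by simp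
    next
      case (2 b)
      then have "b \<in> verts s" using xy(2) graft_verts(2) by blast
      then show ?thesis unfolding x 2 sum_map_simps graft_edges using g a by (simp add: graph_iso_def)
    qed
  qed
  ultimately show ?thesis by (auto simp: graph_iso_def bij_betw_def)
qed

section \<open>Grafting a tree on a couple yields a couple\<close>

lemma path_exists:
  assumes "(x, y) \<in> E\<^sup>*"
  shows "\<exists>p. p \<noteq> [] \<and> hd p = x \<and> last p = y \<and> successively (\<lambda>x y. (x, y) \<in> E) p"
  using assms
proof (induction rule: rtrancl_induct)
  case base
  show ?case by (rule exI[of _ "[x]"]) simp
next
  case (step y z)
  then obtain p where "p \<noteq> []" "hd p = x" "last p = y" "successively (\<lambda>x y. (x, y) \<in> E) p" by blast
  with step(2) show ?case by (intro exI[of _ "p @ [z]"]) (auto simp: successively_append_iff)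
qed

lemma reaches_leaf:
  assumes F: "is_forest t" and "x \<in> verts t"
  shows "\<exists>l\<in>leaves t. (x, l) \<in> (edges t)\<^sup>*"
proof -
  have "wf ((edges t)\<inverse>)"
    using F forest_finite_edges[OF F] by (auto simp: is_forest_def intro: finite_acyclic_wf_converse)
  then show ?thesis using assms(2)
  proof (induction x rule: wf_induct_rule)
    case (less x)
    show ?case
    proof (cases "x \<in> leaves t")
      case False
      then obtain y where y: "(x, y) \<in> edges t" using less.prems by (auto simp: leaves_def)
      then have "y \<in> verts t" using F by (auto simp: is_forest_def)
      then obtain l where "l \<in> leaves t" "(y, l) \<in> (edges t)\<^sup>*" using less.IH[of y] y by auto
      then show ?thesis using y by (meson converse_rtrancl_into_rtrancl)
    qed auto
  qed
qed

lemma path_edges_append: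
  "p \<noteq> [] \<Longrightarrow> q \<noteq> [] \<Longrightarrow> path_edges (p @ q) = path_edges p \<union> path_edges q \<union> {(last p, hd q)}"
proof (induction p)
  case (Cons a p)
  then show ?case by (cases p; cases q) (auto simp: path_edges_def)
qed simp

lemma path_edges_nth: "path_edges p = {(p ! i, p ! Suc i) | i. Suc i < length p}"
  by (auto simp: path_edges_def set_zip nth_tl)

lemma successively_reach:
  "successively (\<lambda>x y. (x, y) \<in> E) p \<Longrightarrow> i \<le> j \<Longrightarrow> j < length p \<Longrightarrow> (p ! i, p ! j) \<in> E\<^sup>*"
proof (induction j)
  case (Suc j)
  show ?case
  proof (cases "i = Suc j")
    case False
    then have "(p ! i, p ! j) \<in> E\<^sup>*" using Suc by auto
    moreover have "(p ! j, p ! Suc j) \<in> E" using Suc.prems by (auto dest: successively_nth)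
    ultimately show ?thesis by auto
  qed auto
qed auto

lemma admissible_iff:
  assumes t: "is_tree t"
  shows "admissible t (Edge_Cut c) \<longleftrightarrow>
    c \<subseteq> edges t \<and> (\<forall>(a, b)\<in>c. \<forall>(x, y)\<in>c. (b, x) \<notin> (edges t)\<^sup>*)"
proof (intro iffI conjI)
  have F: "is_forest t" using t by (simp add: is_tree_def)
  assume adm: "admissible t (Edge_Cut c)"
  then show "c \<subseteq> edges t" by simp
  show "\<forall>(a, b)\<in>c. \<forall>(x, y)\<in>c. (b, x) \<notin> (edges t)\<^sup>*"
  proof (clarify)
    fix a b x y assume c: "(a, b) \<in> c" "(x, y) \<in> c" and r: "(b, x) \<in> (edges t)\<^sup>*"
    have e: "(a, b) \<in> edges t" "(x, y) \<in> edges t" using adm c by auto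
    have av: "a \<in> verts t" "y \<in> verts t" using e F by (auto simp: is_forest_def)
    obtain p where p: "p \<noteq> []" "hd p = the_root t" "last p = a" "successively (\<lambda>x y. (x, y) \<in> edges t) p"
      using path_exists[OF root_reaches[OF t av(1)]] by blast
    obtain q where q: "q \<noteq> []" "hd q = b" "last q = x" "successively (\<lambda>x y. (x, y) \<in> edges t) q"
      using path_exists[OF r] by blast
    obtain l where l: "l \<in> leaves t" "(y, l) \<in> (edges t)\<^sup>*" using reaches_leaf[OF F av(2)] by blast
    obtain u where u: "u \<noteq> []" "hd u = y" "last u = l" "successively (\<lambda>x y. (x, y) \<in> edges t) u"
      using path_exists[OF l(2)] by blast
    let ?p = "p @ q @ u"
    have "root_leaf_path t ?p"
      using p q u l e root_props(1)[OF t] by (auto simp: root_leaf_path_def successively_append_iff)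
    then have "card (c \<inter> path_edges ?p) \<le> 1" using adm by simp
    moreover have "{(a, b), (x, y)} \<subseteq> c \<inter> path_edges ?p"
      using c p q u by (auto simp: path_edges_append)
    moreover have "finite (c \<inter> path_edges ?p)" by (simp add: path_edges_def)
    ultimately have "card {(a, b), (x, y)} \<le> 1" by (meson card_mono order_trans)
    then have "(a, b) = (x, y)" by (cases "(a, b) = (x, y)") (simp_all only: card_insert_if, simp_all)
    then have "(a, a) \<in> (edges t)\<^sup>+" using e(1) r by (auto intro: rtrancl_into_trancl2)
    then show False using F by (auto simp: is_forest_def acyclic_def)
  qed
next
  assume *: "c \<subseteq> edges t \<and> (\<forall>(a, b)\<in>c. \<forall>(x, y)\<in>c. (b, x) \<notin> (edges t)\<^sup>*)"
  have "card (c \<inter> path_edges p) \<le> 1" if "root_leaf_path t p" for p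
  proof -
    have s: "successively (\<lambda>x y. (x, y) \<in> edges t) p" using that by (simp add: root_leaf_path_def)
    have "i = j" if ij: "(p ! i, p ! Suc i) \<in> c" "(p ! j, p ! Suc j) \<in> c"
        "Suc i < length p" "Suc j < length p" for i j
    proof (rule ccontr)
      have False if "i < j" "(p ! i, p ! Suc i) \<in> c" "(p ! j, p ! Suc j) \<in> c" "Suc j < length p" for i j
        using * that successively_reach[OF s, of "Suc i" j] by fastforce
      moreover assume "i \<noteq> j"
      ultimately show False using ij by (metis linorder_neqE_nat)
    qed
    then have "e = e'" if "e \<in> c \<inter> path_edges p" "e' \<in> c \<inter> path_edges p" for e e'
      using that unfolding path_edges_nth by blast
    then show ?thesis by (metis card.infinite card_le_Suc0_iff_eq One_nat_def zero_le)
  qed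
  then show "admissible t (Edge_Cut c)" using * by simp
qed

lemma graft_couple:
  assumes t1: "is_tree t1" and c: "is_couple (t2, s2)" and v: "v \<in> verts s2"
  shows "is_couple (graft t1 v t2, graft t1 v s2)"
proof -
  have t2: "is_tree t2" using c by (simp add: is_couple_def)
  have v2: "v \<in> verts t2" using v couple_verts[OF c] by blast
  let ?G = "graft t1 v t2"
  have G: "is_tree ?G" using graft_tree[OF t1 t2 v2] .
  obtain k where k: "admissible t2 k" "s2 = pruning t2 k" using c by (auto simp: is_couple_def)
  show ?thesis
  proof (cases k)
    case Total_Cut
    then show ?thesis using k G by (auto simp: is_couple_def intro!: exI[of _ Total_Cut])
  next
    case (Edge_Cut c)
    have c: "c \<subseteq> edges t2" "\<And>a b x y. (a, b) \<in> c \<Longrightarrow> (x, y) \<in> c \<Longrightarrow> (b, x) \<notin> (edges t2)\<^sup>*"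
      using k(1) unfolding Edge_Cut admissible_iff[OF t2] by auto
    let ?c = "map_prod odn odn ` c"
    let ?S = "{z \<in> verts ?G. \<exists>(x, y)\<in>?c. (y, z) \<in> (edges ?G)\<^sup>*}"
    have "?c \<subseteq> edges ?G" using c(1) by (auto simp: graft_def)
    moreover have "(b, x) \<notin> (edges ?G)\<^sup>*" if ab: "(a, b) \<in> ?c" "(x, y) \<in> ?c" for a b x y
    proof -
      obtain a' b' x' y' where e: "(a', b') \<in> c" "(x', y') \<in> c" "b = odn b'" "x = odn x'"
        using ab by auto
      show ?thesis unfolding e(3,4) graft_reach_odn_iff using c(2)[OF e(1,2)] .
    qed
    ultimately have adm: "admissible ?G (Edge_Cut ?c)" unfolding admissible_iff[OF G] by blast
    have s2: "s2 = induced t2 {v \<in> verts t2. \<exists>(x, y)\<in>c. (y, v) \<in> (edges t2)\<^sup>*}"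
      using k(2) Edge_Cut by simp
    have Vs2: "x \<in> verts s2 \<longleftrightarrow> x \<in> verts t2 \<and> (\<exists>a b. (a, b) \<in> c \<and> (b, x) \<in> (edges t2)\<^sup>*)" for x
      unfolding s2 induced_def by auto
    have Es2: "edges s2 = edges t2 \<inter> verts s2 \<times> verts s2" unfolding s2 induced_def by simp
    have Seven: "evn x \<in> ?S \<longleftrightarrow> x \<in> verts t1" for x
    proof
      assume "x \<in> verts t1"
      obtain a b where ab: "(a, b) \<in> c" "(b, v) \<in> (edges t2)\<^sup>*" using v Vs2 by blast
      have "(odn b, evn x) \<in> (edges ?G)\<^sup>*"
        unfolding graft_reach_odn_evn_iff using ab(2) root_reaches[OF t1 \<open>x \<in> verts t1\<close>] by blast
      moreover have "(odn a, odn b) \<in> ?c" using map_prod_imageI[OF ab(1)] .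
      ultimately have "\<exists>(x', y)\<in>?c. (y, evn x) \<in> (edges ?G)\<^sup>*"
        by (intro bexI[of _ "(odn a, odn b)"] case_prodI)
      then show "evn x \<in> ?S"
        unfolding mem_Collect_eq graft_verts(1) using \<open>x \<in> verts t1\<close> by (intro conjI)
    qed (simp only: mem_Collect_eq graft_verts(1))
    have Sodd: "odn x \<in> ?S \<longleftrightarrow> x \<in> verts s2" for x
    proof -
      have "(\<exists>(a, b)\<in>?c. (b, odn x) \<in> (edges ?G)\<^sup>*) \<longleftrightarrow>
          (\<exists>(a, b)\<in>c. (odn b, odn x) \<in> (edges ?G)\<^sup>*)"
        by (simp only: bex_simps split_def fst_map_prod snd_map_prod)
      then show ?thesis unfolding graft_reach_odn_iff Vs2 mem_Collect_eq graft_verts by auto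
    qed
    have "z \<in> ?S \<longleftrightarrow> z \<in> verts (graft t1 v s2)" for z
      by (cases z rule: nat_evn_odn) (simp_all only: Seven Sodd graft_verts)
    then have S: "?S = verts (graft t1 v s2)" unfolding set_eq_iff by (rule allI)
    have E1: "edges t1 \<subseteq> verts t1 \<times> verts t1" using t1 by (simp add: is_tree_def is_forest_def)
    have V: "evn x \<in> ?S \<longleftrightarrow> x \<in> verts t1" "odn x \<in> ?S \<longleftrightarrow> x \<in> verts s2" for x
      by (rule Seven, rule Sodd)
    have "(x, y) \<in> edges (graft t1 v s2) \<longleftrightarrow> (x, y) \<in> edges ?G \<and> x \<in> ?S \<and> y \<in> ?S" for x y
    proof (cases x rule: nat_evn_odn; cases y rule: nat_evn_odn)
      fix a b assume e: "x = evn a" "y = evn b"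
      have "(a, b) \<in> edges t1 \<longleftrightarrow> (a, b) \<in> edges t1 \<and> a \<in> verts t1 \<and> b \<in> verts t1" using E1 by blast
      then show ?thesis by (simp only: e graft_edges V)
    next
      fix a b assume e: "x = evn a" "y = odn b"
      then show ?thesis by (simp only: e graft_edges simp_thms)
    next
      fix a b assume e: "x = odn a" "y = evn b"
      have "a = v \<and> b = the_root t1 \<longleftrightarrow> (a = v \<and> b = the_root t1) \<and> a \<in> verts s2 \<and> b \<in> verts t1"
        using v root_props(3)[OF t1] by blast
      then show ?thesis by (simp only: e graft_edges V)
    next
      fix a b assume e: "x = odn a" "y = odn b"
      have "(a, b) \<in> edges s2 \<longleftrightarrow> (a, b) \<in> edges t2 \<and> a \<in> verts s2 \<and> b \<in> verts s2"
        using Es2 by blast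
      then show ?thesis by (simp only: e graft_edges V)
    qed
    then have "edges (graft t1 v s2) = edges ?G \<inter> ?S \<times> ?S"
      unfolding set_eq_iff split_paired_All Int_iff mem_Times_iff fst_conv snd_conv by (intro allI)
    then have "graft t1 v s2 = pruning ?G (Edge_Cut ?c)"
      by (simp only: pruning.simps induced_def S digraph.expand digraph.sel simp_thms)
    then show ?thesis using adm G unfolding is_couple_def by blast
  qed
qed

section \<open>The two products\<close>

lift_definition graft_basis :: "rtree \<Rightarrow> rtree \<Rightarrow> (rtree \<Rightarrow>\<^sub>0 'k::field)" is
  "\<lambda>t s. \<Sum>v\<in>verts s. Poly_Mapping.single (abs_rtree (graft t v s)) 1"
proof -
  fix t t' s s' assume "tree_rel t t'" "tree_rel s s'"
  then obtain f g where t: "is_tree t" "is_tree t'" and f: "graph_iso f t t'"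
    and s: "is_tree s" "is_tree s'" and g: "graph_iso g s s'"
    by (auto simp: tree_rel_def)
  have b: "bij_betw g (verts s) (verts s')" using g by (simp add: graph_iso_def)
  have "abs_rtree (graft t v s) = abs_rtree (graft t' (g v) s')" if v: "v \<in> verts s" for v
  proof -
    have "inj_on g (insert v (verts s))" using b v by (simp add: bij_betw_def insert_absorb)
    then have "graph_iso (sum_map f g) (graft t v s) (graft t' (g v) s')" by (intro graft_iso f t g)
    moreover have "g v \<in> verts s'" using b v by (simp add: bij_betw_apply)
    ultimately have "tree_rel (graft t v s) (graft t' (g v) s')"
      using t s v graft_tree unfolding tree_rel_def by blast
    then show ?thesis by (rule Quotient3_rel_abs[OF Quotient3_rtree])
  qed
  then show "(\<Sum>v\<in>verts s. Poly_Mapping.single (abs_rtree (graft t v s)) (1::'k)) =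
      (\<Sum>v\<in>verts s'. Poly_Mapping.single (abs_rtree (graft t' v s')) 1)"
    by (intro sum.reindex_bij_betw[OF b, THEN trans[rotated]] sum.cong) auto
qed

lift_definition diamond_basis :: "rtree \<Rightarrow> couple \<Rightarrow> (couple \<Rightarrow>\<^sub>0 'k::field)" is
  "\<lambda>t1 (t2, s2). \<Sum>v\<in>verts s2.
     Poly_Mapping.single (abs_couple (graft t1 v t2, graft t1 v s2)) 1"
proof (clarify)
  fix t1 t1' t s t' s' assume "tree_rel t1 t1'" "couple_rel (t, s) (t', s')"
  then obtain f g where t1: "is_tree t1" "is_tree t1'" and f: "graph_iso f t1 t1'"
    and c: "is_couple (t, s)" "is_couple (t', s')" and g: "graph_iso g t t'" "graph_iso g s s'"
    by (auto simp: tree_rel_def couple_rel_def)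
  have b: "bij_betw g (verts s) (verts s')" "bij_betw g (verts t) (verts t')"
    using g by (simp_all add: graph_iso_def)
  have "abs_couple (graft t1 v t, graft t1 v s) = abs_couple (graft t1' (g v) t', graft t1' (g v) s')"
    if v: "v \<in> verts s" for v
  proof -
    have "v \<in> verts t" using v couple_verts[OF c(1)] by blast
    then have "inj_on g (insert v (verts s))" "inj_on g (insert v (verts t))"
      using b v by (simp_all add: bij_betw_def insert_absorb)
    then have "graph_iso (sum_map f g) (graft t1 v t) (graft t1' (g v) t')"
      "graph_iso (sum_map f g) (graft t1 v s) (graft t1' (g v) s')"
      using graft_iso[OF f t1 g(1)] graft_iso[OF f t1 g(2)] by blast+
    moreover have "g v \<in> verts s'" using b v by (simp add: bij_betw_apply)
    ultimately have "couple_rel (graft t1 v t, graft t1 v s) (graft t1' (g v) t', graft t1' (g v) s')"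
      using graft_couple[OF t1(1) c(1) v] graft_couple[OF t1(2) c(2), of "g v"]
      unfolding couple_rel_def by blast
    then show ?thesis by (rule Quotient3_rel_abs[OF Quotient3_couple])
  qed
  then show "(\<Sum>v\<in>verts s. Poly_Mapping.single (abs_couple (graft t1 v t, graft t1 v s)) (1::'k)) =
      (\<Sum>v\<in>verts s'. Poly_Mapping.single (abs_couple (graft t1' v t', graft t1' v s')) 1)"
    by (intro sum.reindex_bij_betw[OF b(1), THEN trans[rotated]] sum.cong) auto
qed

text \<open>\<open>'a \<Rightarrow>\<^sub>0 'k\<close> is the \<open>'k\<close>-vector space with basis \<open>'a\<close>.\<close>

definition pscale :: "'k::field \<Rightarrow> ('a \<Rightarrow>\<^sub>0 'k) \<Rightarrow> ('a \<Rightarrow>\<^sub>0 'k)" where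
  "pscale c = Poly_Mapping.map ((*) c)"

definition bilinear_extension ::
  "('a \<Rightarrow> 'b \<Rightarrow> ('c \<Rightarrow>\<^sub>0 'k::field)) \<Rightarrow> ('a \<Rightarrow>\<^sub>0 'k) \<Rightarrow> ('b \<Rightarrow>\<^sub>0 'k) \<Rightarrow> ('c \<Rightarrow>\<^sub>0 'k)" where
  "bilinear_extension f x y = (\<Sum>a\<in>Poly_Mapping.keys x. \<Sum>b\<in>Poly_Mapping.keys y.
     pscale (Poly_Mapping.lookup x a * Poly_Mapping.lookup y b) (f a b))"

definition grafting :: "(rtree \<Rightarrow>\<^sub>0 'k::field) \<Rightarrow> (rtree \<Rightarrow>\<^sub>0 'k) \<Rightarrow> (rtree \<Rightarrow>\<^sub>0 'k)"
    (infixr "\<rightharpoonup>" 70) where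
  "grafting = bilinear_extension graft_basis"

definition diamond :: "(rtree \<Rightarrow>\<^sub>0 'k::field) \<Rightarrow> (couple \<Rightarrow>\<^sub>0 'k) \<Rightarrow> (couple \<Rightarrow>\<^sub>0 'k)"
    (infixr "\<diamondop>" 70) where
  "diamond = bilinear_extension diamond_basis"

section \<open>Left pre-Lie algebras and modules\<close>

definition bilinear_map ::
  "('k::field \<Rightarrow> 'a::ab_group_add \<Rightarrow> 'a) \<Rightarrow> ('k \<Rightarrow> 'b::ab_group_add \<Rightarrow> 'b) \<Rightarrow>
   ('k \<Rightarrow> 'c::ab_group_add \<Rightarrow> 'c) \<Rightarrow> ('a \<Rightarrow> 'b \<Rightarrow> 'c) \<Rightarrow> bool" where
  "bilinear_map sa sb sc f \<longleftrightarrow>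
     (\<forall>a. Vector_Spaces.linear sb sc (f a)) \<and> (\<forall>b. Vector_Spaces.linear sa sc (\<lambda>a. f a b))"

locale left_prelie_algebra = vector_space scale
  for scale :: "'k::field \<Rightarrow> 'a::ab_group_add \<Rightarrow> 'a" +
  fixes mul :: "'a \<Rightarrow> 'a \<Rightarrow> 'a"
  assumes bilinear_mul: "bilinear_map scale scale scale mul"
    and prelie: "mul a (mul b c) - mul (mul a b) c = mul b (mul a c) - mul (mul b a) c"

locale left_prelie_module =
  A: left_prelie_algebra scaleA mul + M: vector_space scaleM
  for scaleA :: "'k::field \<Rightarrow> 'a::ab_group_add \<Rightarrow> 'a"
    and mul :: "'a \<Rightarrow> 'a \<Rightarrow> 'a"
    and scaleM :: "'k \<Rightarrow> 'm::ab_group_add \<Rightarrow> 'm" +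
  fixes act :: "'a \<Rightarrow> 'm \<Rightarrow> 'm"
  assumes bilinear_act: "bilinear_map scaleA scaleM scaleM act"
    and module_identity: "act a (act b m) - act (mul a b) m = act b (act a m) - act (mul b a) m"

end

theory Submission
  imports Defs
begin

text \<open>In \<open>t1 \<diamondop> (t2 \<diamondop> (t3, s3))\<close> the tree \<open>t1\<close> is grafted either on a vertex of \<open>t2\<close> or on a vertex
  of \<open>s3\<close>. The terms of the first kind add up to \<open>(t1 \<rightharpoonup> t2) \<diamondop> (t3, s3)\<close>; what remains is the sum
  over all ways to graft \<open>t1\<close> and \<open>t2\<close> independently on \<open>s3\<close>, which is symmetric in \<open>t1\<close>
  and \<open>t2\<close>. The same argument with trees in place of couples shows that \<open>\<rightharpoonup>\<close> is pre-Lie.\<close>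

section \<open>Iterated grafting\<close>

lemma graph_iso_inj:
  assumes "inj h"
  shows "graph_iso h (Digraph V E) (Digraph (h ` V) (map_prod h h ` E))"
  using assms by (auto simp: graph_iso_def bij_betw_def inj_on_def map_prod_def)

text \<open>The root of \<open>t\<close> receives the parent \<open>v\<close>, so the only vertex
  left without a parent is the root of \<open>s\<close>.\<close>

lemma graft_root:
  assumes "is_tree t" "is_tree s"
  shows "the_root (graft t v s) = odn (the_root s)"
proof -
  have "roots s = {the_root s}"
    using root_props(1,2)[OF assms(2)] by blast
  then have "roots (graft t v s) = {odn (the_root s)}"
    using graft_roots[OF assms(1)] by simp
  then show ?thesis by (simp add: the_root_def)
qed

text \<open>The two maps below relabel the vertices of iterated grafts and do not depend on the graphs,
  so that each of them transports a tree and a subforest of it at the same time.\<close>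

definition assoc_map :: "nat \<Rightarrow> nat" where
  "assoc_map n = (if even n then 2 * n else if even (n div 2) then n + 1 else n div 2)"

definition swap_map :: "nat \<Rightarrow> nat" where
  "swap_map n = (if even n then 2 * n + 1 else if even (n div 2) then n div 2 else n)"

text \<open>In \<open>graft t1 (evn w) (graft t2 v s)\<close> the vertices of \<open>t1\<close>,
  \<open>t2\<close>, \<open>s\<close> are coded \<open>evn x\<close>, \<open>odn (evn x)\<close>,
  \<open>odn (odn x)\<close>; in \<open>graft (graft t1 w t2) v s\<close> the codes are
  \<open>evn (evn x)\<close>, \<open>evn (odn x)\<close>, \<open>odn x\<close>.\<close>

lemma assoc_map_simps:
  "assoc_map (evn x) = evn (evn x)" "assoc_map (odn (evn x)) = evn (odn x)"
  "assoc_map (odn (odn x)) = odn x"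
  by (simp_all add: assoc_map_def)

lemma swap_map_simps:
  "swap_map (evn x) = odn (evn x)" "swap_map (odn (evn x)) = evn x"
  "swap_map (odn (odn x)) = odn (odn x)"
  by (simp_all add: swap_map_def)

lemma nat_evn_odn_cases:
  fixes n :: nat
  obtains x where "n = evn x" | x where "n = odn (evn x)" | x where "n = odn (odn x)"
  by (metis nat_evn_odn)

lemma evn_odn_eq_iff:
  "evn x = evn y \<longleftrightarrow> x = y" "odn x = odn y \<longleftrightarrow> x = y"
  by simp_all

lemma inj_assoc_map: "inj assoc_map"
proof (rule injI)
  fix m n assume "assoc_map m = assoc_map n"
  then show "m = n"
    by (cases m rule: nat_evn_odn_cases; cases n rule: nat_evn_odn_cases;
        simp only: assoc_map_simps evn_odn_eq_iff evn_odn_neq)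
qed

lemma inj_swap_map: "inj swap_map"
proof (rule injI)
  fix m n assume "swap_map m = swap_map n"
  then show "m = n"
    by (cases m rule: nat_evn_odn_cases; cases n rule: nat_evn_odn_cases;
        simp only: swap_map_simps evn_odn_eq_iff evn_odn_neq)
qed

text \<open>Both graphs are disjoint unions of \<open>t1\<close>, \<open>t2\<close> and
  \<open>s\<close>, joined by edges from \<open>w\<close> to the root of \<open>t1\<close> and from
  \<open>v\<close> to the root of \<open>t2\<close>.\<close>

lemma graft_assoc_iso:
  assumes "is_tree t1" "is_tree t2"
  shows "graph_iso assoc_map (graft t1 (evn w) (graft t2 v s)) (graft (graft t1 w t2) v s)"
proof -
  have "graft (graft t1 w t2) v s =
      Digraph (assoc_map ` verts (graft t1 (evn w) (graft t2 v s)))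
        (map_prod assoc_map assoc_map ` edges (graft t1 (evn w) (graft t2 v s)))"
    \<comment> \<open>Only the outer graft is opened first, so that the root of
      \<open>graft t1 w t2\<close> can be rewritten as that of \<open>t2\<close>.\<close>
    unfolding graft_def[of "graft t1 w t2"] graft_root[OF assms]
    by (simp only: graft_def digraph.sel image_Un image_image image_insert image_empty
        map_prod_simp assoc_map_simps map_prod_def split_def fst_conv snd_conv)
      (simp add: Un_ac insert_commute)
  then show ?thesis using graph_iso_inj[OF inj_assoc_map] by (metis digraph.collapse)
qed

text \<open>Each new edge starts at a vertex of \<open>s\<close>, so the order of the two graftings
  affects only the codes. The case \<open>v = w\<close> is included.\<close>

lemma graft_swap_iso:
  "graph_iso swap_map (graft t1 (odn w) (graft t2 v s)) (graft t2 (odn v) (graft t1 w s))"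
proof -
  have "graft t2 (odn v) (graft t1 w s) =
      Digraph (swap_map ` verts (graft t1 (odn w) (graft t2 v s)))
        (map_prod swap_map swap_map ` edges (graft t1 (odn w) (graft t2 v s)))"
    by (simp only: graft_def digraph.sel image_Un image_image image_insert image_empty
        map_prod_simp swap_map_simps map_prod_def split_def fst_conv snd_conv) (simp add: Un_ac insert_commute)
  then show ?thesis using graph_iso_inj[OF inj_swap_map] by (metis digraph.collapse)
qed

section \<open>Bilinear extension\<close>

lemma lookup_pscale: "Poly_Mapping.lookup (pscale c x) a = c * Poly_Mapping.lookup x a"
  unfolding pscale_def by (simp add: Poly_Mapping.map.rep_eq when_def)

lemma vector_space_pscale: "vector_space pscale"
  by unfold_locales (auto intro!: poly_mapping_eqI simp: lookup_pscale lookup_add algebra_simps)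

text \<open>Supports shrink under cancellation and under scaling by 0. Summing over arbitrary finite
  supersets gives the expressions to be compared a common index set.\<close>

lemma lookup_bilinear_extension:
  assumes "finite A" "Poly_Mapping.keys x \<subseteq> A" "finite B" "Poly_Mapping.keys y \<subseteq> B"
  shows "Poly_Mapping.lookup (bilinear_extension f x y) k =
    (\<Sum>a\<in>A. \<Sum>b\<in>B. Poly_Mapping.lookup x a * Poly_Mapping.lookup y b * Poly_Mapping.lookup (f a b) k)"
proof -
  have "Poly_Mapping.lookup (bilinear_extension f x y) k =
      (\<Sum>a\<in>Poly_Mapping.keys x. \<Sum>b\<in>Poly_Mapping.keys y.
        Poly_Mapping.lookup x a * Poly_Mapping.lookup y b * Poly_Mapping.lookup (f a b) k)"
    by (simp add: bilinear_extension_def lookup_sum lookup_pscale)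
  also have "\<dots> = (\<Sum>a\<in>Poly_Mapping.keys x. \<Sum>b\<in>B.
        Poly_Mapping.lookup x a * Poly_Mapping.lookup y b * Poly_Mapping.lookup (f a b) k)"
    using assms by (intro sum.cong refl sum.mono_neutral_left) (auto simp: in_keys_iff)
  also have "\<dots> = (\<Sum>a\<in>A. \<Sum>b\<in>B.
        Poly_Mapping.lookup x a * Poly_Mapping.lookup y b * Poly_Mapping.lookup (f a b) k)"
    using assms by (intro sum.mono_neutral_left) (auto simp: in_keys_iff)
  finally show ?thesis .
qed

lemma bilinear_extension_add_left:
  "bilinear_extension f (x + x') y = bilinear_extension f x y + bilinear_extension f x' y"
proof (rule poly_mapping_eqI)
  fix k
  let ?A = "Poly_Mapping.keys x \<union> Poly_Mapping.keys x'"
  have "Poly_Mapping.keys (x + x') \<subseteq> ?A" by (rule keys_add)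
  then show "Poly_Mapping.lookup (bilinear_extension f (x + x') y) k =
      Poly_Mapping.lookup (bilinear_extension f x y + bilinear_extension f x' y) k"
    by (simp add: lookup_add lookup_bilinear_extension[where A = ?A and B = "Poly_Mapping.keys y"]
        algebra_simps sum.distrib)
qed

lemma bilinear_extension_add_right:
  "bilinear_extension f x (y + y') = bilinear_extension f x y + bilinear_extension f x y'"
proof (rule poly_mapping_eqI)
  fix k
  let ?B = "Poly_Mapping.keys y \<union> Poly_Mapping.keys y'"
  have "Poly_Mapping.keys (y + y') \<subseteq> ?B" by (rule keys_add)
  then show "Poly_Mapping.lookup (bilinear_extension f x (y + y')) k =
      Poly_Mapping.lookup (bilinear_extension f x y + bilinear_extension f x y') k"
    by (simp add: lookup_add lookup_bilinear_extension[where A = "Poly_Mapping.keys x" and B = ?B]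
        algebra_simps sum.distrib)
qed

lemma keys_pscale_subset: "Poly_Mapping.keys (pscale c x) \<subseteq> Poly_Mapping.keys x"
  by (auto simp: in_keys_iff lookup_pscale)

lemma bilinear_extension_scale_left:
  "bilinear_extension f (pscale c x) y = pscale c (bilinear_extension f x y)"
  by (rule poly_mapping_eqI)
    (simp add: lookup_pscale keys_pscale_subset sum_distrib_left mult_ac
      lookup_bilinear_extension[where A = "Poly_Mapping.keys x" and B = "Poly_Mapping.keys y"])

lemma bilinear_extension_scale_right:
  "bilinear_extension f x (pscale c y) = pscale c (bilinear_extension f x y)"
  by (rule poly_mapping_eqI)
    (simp add: lookup_pscale keys_pscale_subset sum_distrib_left mult_ac
      lookup_bilinear_extension[where A = "Poly_Mapping.keys x" and B = "Poly_Mapping.keys y"])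

lemma bilinear_extension_single:
  "bilinear_extension f (Poly_Mapping.single a 1) (Poly_Mapping.single b 1) = f a b"
  by (rule poly_mapping_eqI)
    (simp add: lookup_bilinear_extension[where A = "{a}" and B = "{b}"])

lemma bilinear_map_bilinear_extension: "bilinear_map pscale pscale pscale (bilinear_extension f)"
  unfolding bilinear_map_def Vector_Spaces.linear_iff
  by (auto intro: vector_space_pscale bilinear_extension_add_left bilinear_extension_add_right
      bilinear_extension_scale_left bilinear_extension_scale_right)

lemma bilinear_extension_sum_left:
  "bilinear_extension f (\<Sum>i\<in>I. x i) y = (\<Sum>i\<in>I. bilinear_extension f (x i) y)"
proof (induction I rule: infinite_finite_induct)
qed (simp_all add: bilinear_extension_add_left, simp_all add: bilinear_extension_def)

lemma bilinear_extension_sum_right: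
  "bilinear_extension f x (\<Sum>i\<in>I. y i) = (\<Sum>i\<in>I. bilinear_extension f x (y i))"
proof (induction I rule: infinite_finite_induct)
qed (simp_all add: bilinear_extension_add_right, simp_all add: bilinear_extension_def)

section \<open>Reduction of left symmetry to basis elements\<close>

lemma poly_mapping_linear_induct [case_names zero add scale single]:
  fixes x :: "'a \<Rightarrow>\<^sub>0 'k::field"
  assumes zero: "P 0" and add: "\<And>x y. P x \<Longrightarrow> P y \<Longrightarrow> P (x + y)"
    and scale: "\<And>c x. P x \<Longrightarrow> P (pscale c x)" and single: "\<And>a. P (Poly_Mapping.single a 1)"
  shows "P x"
proof -
  \<comment> \<open>An infinite \<open>A\<close> is harmless: the sum is then 0 by convention and
    falls under \<open>zero\<close>.\<close>
  have sum: "P (\<Sum>a\<in>A. pscale (c a) (Poly_Mapping.single a 1))" for A c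
    by (induction A rule: infinite_finite_induct) (auto intro: assms)
  have "x = (\<Sum>a\<in>Poly_Mapping.keys x. pscale (Poly_Mapping.lookup x a) (Poly_Mapping.single a 1))"
    by (rule poly_mapping_eqI)
      (simp add: lookup_sum lookup_pscale lookup_single when_def in_keys_iff if_distrib cong: if_cong)
  then show ?thesis using sum by metis
qed

text \<open>Both sides are trilinear in \<open>x\<close>, \<open>y\<close>, \<open>z\<close>, so
  agreement on basis vectors suffices. Taking \<open>g = f\<close> yields the pre-Lie identity, and
  a separate \<open>g\<close> the module identity.\<close>

lemma left_symmetric_bilinear_extension:
  fixes f :: "'a \<Rightarrow> 'a \<Rightarrow> ('a \<Rightarrow>\<^sub>0 'k::field)" and g :: "'a \<Rightarrow> 'm \<Rightarrow> ('m \<Rightarrow>\<^sub>0 'k)"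
  defines "F \<equiv> bilinear_extension f" and "G \<equiv> bilinear_extension g"
  assumes basis: "\<And>a b m. G (Poly_Mapping.single a 1) (g b m) - G (f a b) (Poly_Mapping.single m 1) =
    G (Poly_Mapping.single b 1) (g a m) - G (f b a) (Poly_Mapping.single m 1)"
  shows "G x (G y z) - G (F x y) z = G y (G x z) - G (F y x) z"
proof -
  \<comment> \<open>The claim is symmetry of this associator in its first two arguments; linearity
    in each slot then serves both sides.\<close>
  define A where "A x y z = G x (G y z) - G (F x y) z" for x y z
  have ps: "pscale c u - pscale c v = pscale c (u - v)" for c :: 'k and u v :: "'m \<Rightarrow>\<^sub>0 'k"
    by (rule poly_mapping_eqI) (simp add: lookup_pscale lookup_minus algebra_simps)
  have zero: "A 0 y z = 0" "A x 0 z = 0" "A x y 0 = 0" for x y z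
    by (simp_all add: A_def F_def G_def bilinear_extension_def)
  have add: "A (x + x') y z = A x y z + A x' y z" "A x (y + y') z = A x y z + A x y' z"
      "A x y (z + z') = A x y z + A x y z'" for x x' y y' z z'
    by (simp_all add: A_def F_def G_def bilinear_extension_add_left bilinear_extension_add_right)
  have scale: "A (pscale c x) y z = pscale c (A x y z)" "A x (pscale c y) z = pscale c (A x y z)"
      "A x y (pscale c z) = pscale c (A x y z)" for c x y z
    by (simp_all add: A_def F_def G_def bilinear_extension_scale_left bilinear_extension_scale_right ps)
  have "A x y z = A y x z"
  proof (induction z rule: poly_mapping_linear_induct)
    case (single m)
    show ?case
    proof (induction y rule: poly_mapping_linear_induct)
      case (single b)
      show ?case
      proof (induction x rule: poly_mapping_linear_induct)
        case (single a)
        show ?case using basis[of a b m] by (simp add: A_def F_def G_def bilinear_extension_single)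
      qed (simp_all add: zero add scale)
    qed (simp_all add: zero add scale)
  qed (simp_all add: zero add scale)
  then show ?thesis by (simp add: A_def)
qed

section \<open>The products on basis elements\<close>

text \<open>The quotient is partial, and \<open>tree_rel\<close> relates only trees, so every
  representative is a tree.\<close>

lemma rtree_cases:
  obtains t where "is_tree t" "T = abs_rtree t"
  by (metis Quotient3_def Quotient3_rtree tree_rel_def)

lemma couple_cases:
  obtains t s where "is_couple (t, s)" "C = abs_couple (t, s)"
proof -
  have "couple_rel (rep_couple C) (rep_couple C)" "abs_couple (rep_couple C) = C"
    using Quotient3_couple by (simp_all add: Quotient3_def)
  then show ?thesis using that by (cases "rep_couple C") (auto simp: couple_rel_def)
qed

lemma graft_basis_abs:
  assumes "is_tree t" "is_tree s"
  shows "graft_basis (abs_rtree t) (abs_rtree s) =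
    (\<Sum>v\<in>verts s. Poly_Mapping.single (abs_rtree (graft t v s)) (1 :: 'k::field))"
  using assms graph_iso_id by (intro graft_basis.abs_eq) (auto simp: tree_rel_def)

lemma diamond_basis_abs:
  assumes "is_tree t1" "is_couple (t2, s2)"
  shows "diamond_basis (abs_rtree t1) (abs_couple (t2, s2)) =
    (\<Sum>v\<in>verts s2. Poly_Mapping.single (abs_couple (graft t1 v t2, graft t1 v s2)) (1 :: 'k::field))"
proof -
  have "tree_rel t1 t1" "couple_rel (t2, s2) (t2, s2)"
    using assms graph_iso_id by (auto simp: tree_rel_def couple_rel_def)
  then show ?thesis using diamond_basis.abs_eq by fastforce
qed

lemma abs_rtree_eqI:
  assumes "is_tree t" "is_tree t'" "graph_iso f t t'"
  shows "abs_rtree t = abs_rtree t'"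
  using assms by (intro Quotient3_rel_abs[OF Quotient3_rtree]) (auto simp: tree_rel_def)

lemma abs_couple_eqI:
  assumes "is_couple (t, s)" "is_couple (t', s')" "graph_iso f t t'" "graph_iso f s s'"
  shows "abs_couple (t, s) = abs_couple (t', s')"
  using assms by (intro Quotient3_rel_abs[OF Quotient3_couple]) (auto simp: couple_rel_def)

lemma finite_verts: "is_tree t \<Longrightarrow> finite (verts t)"
  by (simp add: is_tree_def is_forest_def)

text \<open>Even and odd codes are disjoint. In the associators the first sum is cancelled by the
  subtracted term and the second one survives.\<close>

lemma sum_verts_graft:
  assumes "finite (verts t)" "finite (verts s)"
  shows "(\<Sum>w\<in>verts (graft t v s). h w) = (\<Sum>w\<in>verts t. h (evn w)) + (\<Sum>w\<in>verts s. h (odn w))"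
proof -
  have "(\<Sum>w\<in>verts (graft t v s). h w) = sum h (evn ` verts t) + sum h (odn ` verts s)"
    unfolding graft_def digraph.sel using assms evn_odn_neq by (intro sum.union_disjoint) auto
  then show ?thesis by (simp add: sum.reindex inj_on_def)
qed

section \<open>Left symmetry on basis elements\<close>

lemma graft_basis_left_symmetric:
  fixes a b c :: rtree
  shows "bilinear_extension graft_basis (Poly_Mapping.single a (1 :: 'k::field)) (graft_basis b c) -
      bilinear_extension graft_basis (graft_basis a b) (Poly_Mapping.single c 1) =
    bilinear_extension graft_basis (Poly_Mapping.single b 1) (graft_basis a c) -
      bilinear_extension graft_basis (graft_basis b a) (Poly_Mapping.single c 1)"
proof -
  obtain t1 t2 t3 where t: "is_tree t1" "is_tree t2" "is_tree t3"
    and abc: "a = abs_rtree t1" "b = abs_rtree t2" "c = abs_rtree t3"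
    by (metis rtree_cases)
  \<comment> \<open>What survives of the associator: \<open>q\<close> grafted at \<open>v\<close>
    and \<open>p\<close> at \<open>w\<close>, over all pairs of vertices of \<open>t3\<close>, equal
    ones included.\<close>
  define D :: "nat digraph \<Rightarrow> nat digraph \<Rightarrow> rtree \<Rightarrow>\<^sub>0 'k" where
    "D p q = (\<Sum>v\<in>verts t3. \<Sum>w\<in>verts t3. Poly_Mapping.single (abs_rtree (graft p (odn w) (graft q v t3))) 1)"
    for p q
  have associator: "bilinear_extension graft_basis (Poly_Mapping.single (abs_rtree p) 1)
        (graft_basis (abs_rtree q) (abs_rtree t3)) -
      bilinear_extension graft_basis (graft_basis (abs_rtree p) (abs_rtree q))
        (Poly_Mapping.single (abs_rtree t3) 1) = D p q" if p: "is_tree p" and q: "is_tree q" for p q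
  proof -
    have "abs_rtree (graft p (evn w) (graft q v t3)) = abs_rtree (graft (graft p w q) v t3)"
      if "v \<in> verts t3" "w \<in> verts q" for v w
    proof (rule abs_rtree_eqI[OF _ _ graft_assoc_iso[OF p q]])
      have "evn w \<in> verts (graft q v t3)" unfolding graft_verts by (rule that)
      then show "is_tree (graft p (evn w) (graft q v t3))" "is_tree (graft (graft p w q) v t3)"
        using p q t that by (blast intro: graft_tree)+
    qed
    then have "(\<Sum>v\<in>verts t3. \<Sum>w\<in>verts q. Poly_Mapping.single (abs_rtree (graft p (evn w) (graft q v t3))) 1) =
        (\<Sum>w\<in>verts q. \<Sum>v\<in>verts t3. Poly_Mapping.single (abs_rtree (graft (graft p w q) v t3)) (1 :: 'k))"
      by (subst sum.swap) simp
    moreover have "bilinear_extension graft_basis (Poly_Mapping.single (abs_rtree p) 1)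
        (graft_basis (abs_rtree q) (abs_rtree t3)) =
        (\<Sum>v\<in>verts t3. \<Sum>w\<in>verts (graft q v t3).
          Poly_Mapping.single (abs_rtree (graft p w (graft q v t3))) (1 :: 'k))"
      using p q t by (simp add: graft_basis_abs graft_tree bilinear_extension_sum_right bilinear_extension_single)
    moreover have "bilinear_extension graft_basis (graft_basis (abs_rtree p) (abs_rtree q))
        (Poly_Mapping.single (abs_rtree t3) 1) =
        (\<Sum>w\<in>verts q. \<Sum>v\<in>verts t3. Poly_Mapping.single (abs_rtree (graft (graft p w q) v t3)) (1 :: 'k))"
      using p q t by (simp add: graft_basis_abs graft_tree bilinear_extension_sum_left bilinear_extension_single)
    \<comment> \<open>The inner sum over \<open>graft q v t3\<close> splits; its part over
      \<open>q\<close> is exactly the subtracted double sum.\<close>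
    ultimately show ?thesis
      using p q t by (simp only: D_def sum_verts_graft finite_verts sum.distrib add_diff_cancel_left')
  qed
  have "abs_rtree (graft t1 (odn w) (graft t2 v t3)) = abs_rtree (graft t2 (odn v) (graft t1 w t3))"
    if "v \<in> verts t3" "w \<in> verts t3" for v w
  proof (rule abs_rtree_eqI[OF _ _ graft_swap_iso])
    have "odn w \<in> verts (graft t2 v t3)" "odn v \<in> verts (graft t1 w t3)"
      unfolding graft_verts by (rule that)+
    then show "is_tree (graft t1 (odn w) (graft t2 v t3))" "is_tree (graft t2 (odn v) (graft t1 w t3))"
      using t that by (blast intro: graft_tree)+
  qed
  \<comment> \<open>After exchanging the two summations the terms agree one by one, by
    \<open>graft_swap_iso\<close>.\<close>
  then have "D t1 t2 = D t2 t1"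
    unfolding D_def by (subst sum.swap) simp
  then show ?thesis unfolding abc using associator[OF t(1,2)] associator[OF t(2,1)] by (simp only:)
qed

text \<open>Grafting \<open>q\<close> at a vertex of \<open>s3\<close> puts all of \<open>q\<close>
  into the new subforest. The second action therefore meets every vertex of \<open>q\<close>, and
  these terms cancel against the full product of \<open>p\<close> and \<open>q\<close>.\<close>

lemma diamond_basis_left_symmetric:
  fixes a b :: rtree and c :: couple
  shows "bilinear_extension diamond_basis (Poly_Mapping.single a (1 :: 'k::field)) (diamond_basis b c) -
      bilinear_extension diamond_basis (graft_basis a b) (Poly_Mapping.single c 1) =
    bilinear_extension diamond_basis (Poly_Mapping.single b 1) (diamond_basis a c) -
      bilinear_extension diamond_basis (graft_basis b a) (Poly_Mapping.single c 1)"
proof -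
  obtain t1 t2 where t: "is_tree t1" "is_tree t2" and ab: "a = abs_rtree t1" "b = abs_rtree t2"
    by (metis rtree_cases)
  obtain t3 s3 where cp: "is_couple (t3, s3)" and c: "c = abs_couple (t3, s3)"
    by (rule couple_cases)
  have fin: "finite (verts s3)"
    using cp couple_verts[OF cp] finite_verts[of t3] by (auto simp: is_couple_def intro: finite_subset)
  define D :: "nat digraph \<Rightarrow> nat digraph \<Rightarrow> couple \<Rightarrow>\<^sub>0 'k" where
    "D p q = (\<Sum>v\<in>verts s3. \<Sum>w\<in>verts s3.
      Poly_Mapping.single (abs_couple (graft p (odn w) (graft q v t3), graft p (odn w) (graft q v s3))) 1)"
    for p q
  have associator: "bilinear_extension diamond_basis (Poly_Mapping.single (abs_rtree p) 1)
        (diamond_basis (abs_rtree q) (abs_couple (t3, s3))) -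
      bilinear_extension diamond_basis (graft_basis (abs_rtree p) (abs_rtree q))
        (Poly_Mapping.single (abs_couple (t3, s3)) 1) = D p q" if p: "is_tree p" and q: "is_tree q" for p q
  proof -
    have "abs_couple (graft p (evn w) (graft q v t3), graft p (evn w) (graft q v s3)) =
        abs_couple (graft (graft p w q) v t3, graft (graft p w q) v s3)"
      if "v \<in> verts s3" "w \<in> verts q" for v w
    \<comment> \<open>A single relabelling must work for tree and subforest alike;
      \<open>assoc_map\<close> is independent of the graphs, so it applies to \<open>t3\<close> and
      \<open>s3\<close> together.\<close>
    proof (rule abs_couple_eqI[OF _ _ graft_assoc_iso[OF p q] graft_assoc_iso[OF p q]])
      \<comment> \<open>\<open>graft_couple\<close> asks for a vertex of the subforest, not merely
        of the tree.\<close>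
      have "evn w \<in> verts (graft q v s3)" unfolding graft_verts by (rule that)
      then show "is_couple (graft p (evn w) (graft q v t3), graft p (evn w) (graft q v s3))"
        "is_couple (graft (graft p w q) v t3, graft (graft p w q) v s3)"
        using p q cp that by (blast intro: graft_tree graft_couple)+
    qed
    then have "(\<Sum>v\<in>verts s3. \<Sum>w\<in>verts q. Poly_Mapping.single
          (abs_couple (graft p (evn w) (graft q v t3), graft p (evn w) (graft q v s3))) 1) =
        (\<Sum>w\<in>verts q. \<Sum>v\<in>verts s3. Poly_Mapping.single
          (abs_couple (graft (graft p w q) v t3, graft (graft p w q) v s3)) (1 :: 'k))"
      by (subst sum.swap) simp
    moreover have "bilinear_extension diamond_basis (Poly_Mapping.single (abs_rtree p) 1)
        (diamond_basis (abs_rtree q) (abs_couple (t3, s3))) =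
        (\<Sum>v\<in>verts s3. \<Sum>w\<in>verts (graft q v s3). Poly_Mapping.single
          (abs_couple (graft p w (graft q v t3), graft p w (graft q v s3))) (1 :: 'k))"
      using p q cp
      by (simp add: diamond_basis_abs graft_couple bilinear_extension_sum_right bilinear_extension_single)
    moreover have "bilinear_extension diamond_basis (graft_basis (abs_rtree p) (abs_rtree q))
        (Poly_Mapping.single (abs_couple (t3, s3)) 1) =
        (\<Sum>w\<in>verts q. \<Sum>v\<in>verts s3. Poly_Mapping.single
          (abs_couple (graft (graft p w q) v t3, graft (graft p w q) v s3)) (1 :: 'k))"
      using p q cp
      by (simp add: graft_basis_abs diamond_basis_abs graft_tree bilinear_extension_sum_left
          bilinear_extension_single)
    ultimately show ?thesis
      using p q fin by (simp only: D_def sum_verts_graft finite_verts sum.distrib add_diff_cancel_left')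
  qed
  have "abs_couple (graft t1 (odn w) (graft t2 v t3), graft t1 (odn w) (graft t2 v s3)) =
      abs_couple (graft t2 (odn v) (graft t1 w t3), graft t2 (odn v) (graft t1 w s3))"
    if "v \<in> verts s3" "w \<in> verts s3" for v w
  proof (rule abs_couple_eqI[OF _ _ graft_swap_iso graft_swap_iso])
    have "odn w \<in> verts (graft t2 v s3)" "odn v \<in> verts (graft t1 w s3)"
      unfolding graft_verts by (rule that)+
    then show "is_couple (graft t1 (odn w) (graft t2 v t3), graft t1 (odn w) (graft t2 v s3))"
      "is_couple (graft t2 (odn v) (graft t1 w t3), graft t2 (odn v) (graft t1 w s3))"
      using t cp that by (blast intro: graft_couple)+
  qed
  then have "D t1 t2 = D t2 t1"
    unfolding D_def by (subst sum.swap) simp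
  then show ?thesis unfolding ab c using associator[OF t(1,2)] associator[OF t(2,1)] by (simp only:)
qed

theorem theorem7:
  shows "left_prelie_module
      (pscale :: 'k::field \<Rightarrow> (rtree \<Rightarrow>\<^sub>0 'k) \<Rightarrow> (rtree \<Rightarrow>\<^sub>0 'k)) grafting
      (pscale :: 'k \<Rightarrow> (couple \<Rightarrow>\<^sub>0 'k) \<Rightarrow> (couple \<Rightarrow>\<^sub>0 'k)) diamond \<and>
    (\<forall>(t1 :: rtree \<Rightarrow>\<^sub>0 'k) (t2 :: rtree \<Rightarrow>\<^sub>0 'k) (m3 :: couple \<Rightarrow>\<^sub>0 'k).
      t1 \<diamondop> (t2 \<diamondop> m3) - (t1 \<rightharpoonup> t2) \<diamondop> m3 =
      t2 \<diamondop> (t1 \<diamondop> m3) - (t2 \<rightharpoonup> t1) \<diamondop> m3)"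
proof -
  have alg: "x \<rightharpoonup> (y \<rightharpoonup> z) - (x \<rightharpoonup> y) \<rightharpoonup> z = y \<rightharpoonup> (x \<rightharpoonup> z) - (y \<rightharpoonup> x) \<rightharpoonup> z"
    for x y z :: "rtree \<Rightarrow>\<^sub>0 'k"
    unfolding grafting_def
    \<comment> \<open>Here the algebra acts on itself: both basis products are
      \<open>graft_basis\<close>.\<close>
    by (rule left_symmetric_bilinear_extension) (rule graft_basis_left_symmetric)
  have act: "x \<diamondop> (y \<diamondop> z) - (x \<rightharpoonup> y) \<diamondop> z = y \<diamondop> (x \<diamondop> z) - (y \<rightharpoonup> x) \<diamondop> z"
    for x y :: "rtree \<Rightarrow>\<^sub>0 'k" and z :: "couple \<Rightarrow>\<^sub>0 'k"
    unfolding grafting_def diamond_def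
    by (rule left_symmetric_bilinear_extension) (rule diamond_basis_left_symmetric)
  have "left_prelie_module
      (pscale :: 'k \<Rightarrow> (rtree \<Rightarrow>\<^sub>0 'k) \<Rightarrow> (rtree \<Rightarrow>\<^sub>0 'k)) grafting
      (pscale :: 'k \<Rightarrow> (couple \<Rightarrow>\<^sub>0 'k) \<Rightarrow> (couple \<Rightarrow>\<^sub>0 'k)) diamond"
    by (intro left_prelie_module.intro left_prelie_algebra.intro left_prelie_algebra_axioms.intro
        left_prelie_module_axioms.intro vector_space_pscale alg act)
      (simp_all add: grafting_def diamond_def bilinear_map_bilinear_extension)
  then show ?thesis using act by blast
qed

end
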